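(* Let $f_1,\dots,f_m:\mathbb{R}^n\to\mathbb{R}$ be convex, let $F(x)=\sum_{i=1}^m f_i(x_i)$ for $x=[x_1^T,\dots,x_m^T]^T\in\mathbb{R}^{mn}$, and let $W=\bar W\otimes I_n$, where $\bar W$ is the Laplacian of a fixed connected undirected graph on $m$ nodes. Assume that $F$ is dual-friendly and $M$-Lipschitz. Let $\varepsilon>0$, let $c=x^*(z_0)$ be the primal point associated with the dual starting point $z_0=0$, let $x^*$ be the solution of $\min_{\sqrt W x=0}F(x)$ closest to $c$, let $R_x=\|x^*-c\|_2$, and let $R<\infty$ be the smallest Euclidean norm of a minimizer of the dual function. Set $\mu=\varepsilon/R_x^2$, $F^\mu(x)=F(x)+\frac{\mu}{2}\|x-c\|_2^2$, let $\varphi(y)=\max_x\{\langle\sqrt W y,x\rangle-F^\mu(x)\}$ be the dual function of the regularized function $F^\mu$, and set $\mu_\varphi=\varepsilon/R^2$ and $\varphi^{\mu_\varphi}(y)=\varphi(y)+\frac{\mu_\varphi}{2}\|y\|_2^2$. Then, after $$N=\tilde O\left(\sqrt{\frac{M^2R_x^2}{\varepsilon^2}\,\chi(W)}\right)$$ iterations (oracle calls) of the distributed fast gradient method applied to the regularized dual problem $\min_y\varphi^{\mu_\varphi}(y)$, the point $x^*(z_N)$ (the primal point associated with $z_N$ for $F^\mu$) is an $(\varepsilon,\varepsilon/R)$-optimal solution of the problem $\min_{\sqrt W x=0}F(x)$.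
   Context: All norms are Euclidean. The Laplacian $\bar W\in\mathbb{R}^{m\times m}$ of a graph $\mathcal G=(V,E)$ with $|V|=m$ is $[\bar W]_{ij}=-1$ if $(i,j)\in E$, $[\bar W]_{ii}=\deg(i)$, and $0$ otherwise. The matrix $W=\bar W\otimes I_n$ is symmetric positive semidefinite, $\sqrt W$ is its positive semidefinite square root, and $\sqrt W x=0$ if and only if $x_1=\dots=x_m$. $\lambda_{\max}(W)$ and $\lambda_{\min}^+(W)$ denote the largest and the smallest nonzero eigenvalue of $W$, and $\chi(W)=\lambda_{\max}(W)/\lambda_{\min}^+(W)$. $F$ is $M$-Lipschitz if it is Lipschitz continuous with constant $M$ in the Euclidean norm. $R=\|y^*\|_2$, where $y^*$ is the smallest-norm solution of the dual problem $\min_y\max_x\{\langle\sqrt W y,x\rangle-F(x)\}$; it is assumed throughout that $R<\infty$. The primal point associated with $z\in\mathbb{R}^{mn}$ for a function $H$ is $\arg\max_x\{\langle z,x\rangle-H(x)\}$. In particular $c=x^*(z_0)$ with $z_0=0$ is a minimizer of $F$ over $\mathbb{R}^{mn}$ (equivalently, the minimizer of $F^\mu$). In the iteration below $x^*(z)=\arg\max_x\{\langle z,x\rangle-F^\mu(x)\}$, which splits into blocks $x_j^*(z^j)=\arg\max_{x_j\in\mathbb{R}^n}\{\langle z^j,x_j\rangle-f_j(x_j)-\frac{\mu}{2}\|x_j-c_j\|_2^2\}$. Dual-friendly means that these maximizers are available explicitly (or can be computed efficiently), so they are treated as returned exactly by an oracle; one iteration is one oracle call. Distributed fast gradient method on $\varphi^{\mu_\varphi}$: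 this is Nesterov's fast gradient method $y_{k+1}=\tilde y_k-\frac1\ell\nabla\varphi^{\mu_\varphi}(\tilde y_k)$, $\tilde y_{k+1}=y_{k+1}+\frac{\sqrt\ell-\sqrt{\mu_\varphi}}{\sqrt\ell+\sqrt{\mu_\varphi}}(y_{k+1}-y_k)$, $y_0=\tilde y_0=0$, with $\ell=\lambda_{\max}(W)/\mu+\mu_\varphi$ and $\nabla\varphi^{\mu_\varphi}(y)=\sqrt W x^*(\sqrt W y)+\mu_\varphi y$, run in the variables $z_k=\sqrt W y_k$, $\tilde z_k=\sqrt W\tilde y_k$; that is, $z_0=\tilde z_0=0$ and node $i$ computes $$z_{k+1}^i=\tilde z_k^i-\frac1\ell\Big(\sum_{j=1}^m W_{ij}x_j^*(\tilde z_k^j)+\mu_\varphi\tilde z_k^i\Big),\qquad \tilde z_{k+1}^i=z_{k+1}^i+\frac{\sqrt\ell-\sqrt{\mu_\varphi}}{\sqrt\ell+\sqrt{\mu_\varphi}}(z_{k+1}^i-z_k^i),$$ with $W_{ij}=[\bar W]_{ij}\otimes I_n$. A point $\hat x$ is an $(\varepsilon,\tilde\varepsilon)$-optimal solution of $\min_{\sqrt W x=0}F(x)$ if $F(\hat x)-F(x^* )\le\varepsilon$ and $\|\sqrt W\hat x\|_2\le\tilde\varepsilon$. The notation $\tilde O$ hides universal constants and factors logarithmic in the problem parameters.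
   Formalization: R is the smallest norm of a minimizer of φ, the dual of the regularized F^μ (with the dual of F the claim is false); M²R_x²/ε² in the iteration bound is replaced by max(1, M²R_x²/ε²); R_x>0 is assumed so that μ is defined. *)

theory Defs
  imports "HOL-Analysis.Analysis"
begin

text \<open>
  A vector of \<open>\<real>\<^sup>m\<^sup>n\<close> is a term \<open>x :: real^'n^'m\<close>: its blocks are \<open>x $ i :: real^'n\<close>, and the
  norm and inner product of this type are the Euclidean ones of the stacked vector. The nodes of
  the graph are all elements of \<open>'m\<close>.
\<close>

definition connected_graph :: "('m::finite \<times> 'm) set \<Rightarrow> bool" where
  "connected_graph E \<longleftrightarrow> sym E \<and> irrefl E \<and> (\<forall>i j. (i, j) \<in> E\<^sup>*)"

definition laplacian :: "('m::finite \<times> 'm) set \<Rightarrow> real^'m^'m" where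
  "laplacian E = (\<chi> i j. if i = j then real (card {k. (i, k) \<in> E})
                         else if (i, j) \<in> E then -1 else 0)"

text \<open>The Kronecker product of \<open>A\<close> with the identity of \<open>\<real>\<^sup>n\<close>, as a linear operator: its
  \<open>(i, j)\<close> block is \<open>A $ i $ j\<close> times the identity.\<close>

definition kron_id :: "real^'m^'m \<Rightarrow> real^'n^'m::finite \<Rightarrow> real^'n^'m" where
  "kron_id A x = (\<chi> i. \<Sum>j\<in>UNIV. (A $ i $ j) *\<^sub>R (x $ j))"

text \<open>A positive semidefinite operator has exactly one such square root.\<close>

definition psd_sqrt :: "('v::euclidean_space \<Rightarrow> 'v) \<Rightarrow> ('v \<Rightarrow> 'v) \<Rightarrow> bool" where
  "psd_sqrt S T \<longleftrightarrow>
     linear S \<and> adjoint S = S \<and> (\<forall>x. 0 \<le> x \<bullet> S x) \<and> (\<forall>x. S (S x) = T x)"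

definition eigenvalues :: "('v::real_vector \<Rightarrow> 'v) \<Rightarrow> real set" where
  "eigenvalues T = {r. \<exists>v. v \<noteq> 0 \<and> T v = r *\<^sub>R v}"

definition lambda_max :: "('v::real_vector \<Rightarrow> 'v) \<Rightarrow> real" where
  "lambda_max T = Max (eigenvalues T)"

definition lambda_min_pos :: "('v::real_vector \<Rightarrow> 'v) \<Rightarrow> real" where
  "lambda_min_pos T = Min (eigenvalues T - {0})"

definition cond_number :: "('v::real_vector \<Rightarrow> 'v) \<Rightarrow> real" where
  "cond_number T = lambda_max T / lambda_min_pos T"

definition regularize :: "real \<Rightarrow> 'v::real_normed_vector \<Rightarrow> ('v \<Rightarrow> real) \<Rightarrow> 'v \<Rightarrow> real" where
  "regularize mu c H x = H x + mu / 2 * (norm (x - c))\<^sup>2"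

text \<open>The two functions below are used only for \<open>H\<close> regularized with positive weight and convex, so that
  the maximum is finite, attained, and attained only once.\<close>

definition primal_point :: "('v::real_inner \<Rightarrow> real) \<Rightarrow> 'v \<Rightarrow> 'v" where
  "primal_point H z = (ARG_MAX (\<lambda>x. z \<bullet> x - H x) x. True)"

definition dual_fun :: "('v::real_inner \<Rightarrow> 'v) \<Rightarrow> ('v \<Rightarrow> real) \<Rightarrow> 'v \<Rightarrow> real" where
  "dual_fun S H y = (SUP x. S y \<bullet> x - H x)"

text \<open>\<open>\<O>~(X)\<close> with its universal constant and its logarithmic factor written out. The constant is
  explicit because the dimensions are types: a constant quantified existentially inside a theorem
  could depend on them, and for a fixed number of nodes it could absorb the condition number.\<close>

definition soft_O :: "real \<Rightarrow> real" where
  "soft_O X = 100 * X * (1 + ln X)"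

end

theory Submission
  imports Defs
begin

text \<open>
  Strong convexity of the regularized primal function makes the dual function smooth with constant
  \<open>\<Lambda> / \<mu>\<close>, where \<open>\<Lambda>\<close> is the largest eigenvalue of \<open>W\<close>, and its gradient at \<open>y\<close> is \<open>S\<close> applied to the
  primal point of \<open>S y\<close>. The fast gradient method therefore converges linearly to the minimizer of the
  regularized dual function, at a rate governed by \<open>\<kappa> = \<Lambda> / (\<mu> \<mu>\<phi>) + 1\<close>. The minimal-norm dual solution is
  orthogonal to the kernel of \<open>S\<close>, and \<open>S ys\<close> is a subgradient of the regularized function, which bounds
  \<open>R\<close> by \<open>M + \<epsilon> / Rx\<close> over the root of the least positive eigenvalue and thus \<open>\<kappa>\<close> by \<open>5 X\<^sup>2\<close>, where \<open>X\<close>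
  is the argument of \<open>soft_O\<close>. The target accuracy, relative to \<open>R\<close>, is polynomial in \<open>\<kappa>\<close>, so only
  \<open>ln X\<close> enters the iteration count. Infeasibility is the norm of the dual gradient, and the objective
  gap follows from weak duality.
\<close>

section \<open>Proximal points of convex functions\<close>

lemma norm_convex_combination_power2:
  fixes p x c :: "'v::real_inner"
  shows "(norm (p + t *\<^sub>R (x - p) - c))\<^sup>2
    = (1 - t) * (norm (p - c))\<^sup>2 + t * (norm (x - c))\<^sup>2 - t * (1 - t) * (norm (x - p))\<^sup>2"
  unfolding power2_norm_eq_inner
  by (simp add: algebra_simps inner_commute power2_eq_square)

lemma norm_power2_expand:
  fixes w y :: "'v::real_inner"
  shows "(norm w)\<^sup>2 = (norm y)\<^sup>2 + 2 * (y \<bullet> (w - y)) + (norm (w - y))\<^sup>2"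
  unfolding power2_norm_eq_inner by (simp add: inner_diff inner_commute algebra_simps)

text \<open>Convexity lets \<open>G\<close> fall at most linearly away from \<open>c\<close>, so the
  quadratic term wins outside a large ball, and compactness gives a minimizer inside it.\<close>

lemma regularized_minimizer_exists:
  fixes G :: "'v::euclidean_space \<Rightarrow> real"
  assumes cv: "convex_on UNIV G" and mu: "mu > 0"
  obtains p where "\<And>x. regularize mu c G p \<le> regularize mu c G x"
proof -
  have contG: "continuous_on S G" for S
    using convex_on_continuous[OF open_UNIV cv] continuous_on_subset by blast
  have "\<exists>q\<in>cball c 1. \<forall>x\<in>cball c 1. G q \<le> G x"
    by (rule continuous_attains_inf) (auto intro: contG)
  then obtain q where q: "\<And>x. x \<in> cball c 1 \<Longrightarrow> G q \<le> G x" by blast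
  define A where "A = G c - G q"
  have A: "A \<ge> 0" using q[of c] by (simp add: A_def)
  \<comment> \<open>Beyond this radius \<open>mu / 2 * r\<^sup>2\<close> outweighs the linear loss
    \<open>r * A\<close>. Being at least 1, it also puts the point at distance 1 from
    \<open>c\<close> on the segment to any \<open>x\<close> outside the ball.\<close>
  define r0 where "r0 = max 1 (2 * A / mu)"
  have "continuous_on (cball c r0) (regularize mu c G)"
    unfolding regularize_def[abs_def] by (intro continuous_intros contG)
  then have "\<exists>p\<in>cball c r0. \<forall>x\<in>cball c r0. regularize mu c G p \<le> regularize mu c G x"
    by (rule continuous_attains_inf[rotated 2]) (auto simp: r0_def)
  then obtain p where p: "\<And>x. x \<in> cball c r0 \<Longrightarrow> regularize mu c G p \<le> regularize mu c G x"
    by blast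
  have "regularize mu c G p \<le> regularize mu c G x" for x
  proof (cases "x \<in> cball c r0")
    case True
    then show ?thesis by (rule p)
  next
    case False
    define r where "r = norm (x - c)"
    have r: "r > r0" using False by (simp add: r_def dist_norm norm_minus_commute)
    then have r1: "r > 1" "2 * A / mu < r" by (auto simp: r0_def)
    have "G q \<le> G (c + (1 / r) *\<^sub>R (x - c))"
      using r1 by (intro q) (simp add: dist_norm r_def)
    also have "c + (1 / r) *\<^sub>R (x - c) = (1 - 1 / r) *\<^sub>R c + (1 / r) *\<^sub>R x"
      by (simp add: algebra_simps)
    also have "G \<dots> \<le> (1 - 1 / r) * G c + (1 / r) * G x"
      using convex_onD[OF cv, of "1 / r" c x] r1 by simp
    finally have "r * G q \<le> r * ((1 - 1 / r) * G c + (1 / r) * G x)"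
      using r1 by (intro mult_left_mono) auto
    then have 1: "G c - r * A \<le> G x"
      using r1 by (simp add: A_def algebra_simps)
    have "2 * A \<le> mu * r" using r1 mu by (simp add: field_simps)
    then have "r * (2 * A) \<le> r * (mu * r)" using r1 by (intro mult_left_mono) auto
    then have 2: "r * A \<le> mu / 2 * r\<^sup>2" by (simp add: power2_eq_square mult_ac)
    have "regularize mu c G p \<le> regularize mu c G c" by (rule p) (simp add: r0_def)
    also have "\<dots> \<le> regularize mu c G x"
      using 1 2 by (simp add: regularize_def r_def)
    finally show ?thesis .
  qed
  then show thesis by (rule that)
qed

lemma regularized_arg_max_exists:
  fixes G :: "'v::euclidean_space \<Rightarrow> real"
  assumes cv: "convex_on UNIV G" and mu: "mu > 0"
  shows "\<exists>p. is_arg_max (\<lambda>x. z \<bullet> x - regularize mu c G x) (\<lambda>_. True) p"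
proof -
  have "concave_on UNIV (\<lambda>x. z \<bullet> x)"
    unfolding concave_on_def by (rule convex_onI) (auto simp: inner_add_right)
  then have "convex_on UNIV (\<lambda>x. G x - z \<bullet> x)"
    using cv by (intro convex_on_diff)
  then obtain p where p: "\<And>x. regularize mu c (\<lambda>x. G x - z \<bullet> x) p \<le> regularize mu c (\<lambda>x. G x - z \<bullet> x) x"
    using regularized_minimizer_exists[OF _ mu] by blast
  have "z \<bullet> x - regularize mu c G x \<le> z \<bullet> p - regularize mu c G p" for x
    using p[of x] by (simp add: regularize_def)
  then show ?thesis by (auto simp: is_arg_max_def not_less)
qed

text \<open>Comparing \<open>p\<close> with the point a fraction \<open>t\<close> of the way to
  \<open>x\<close> and dividing by \<open>t\<close> gives the bound up to a factor
  \<open>1 - t\<close>, which tends to 1 with \<open>t\<close> tending to 0.\<close>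

lemma is_arg_max_regularize_growth:
  fixes G :: "'v::euclidean_space \<Rightarrow> real"
  assumes cv: "convex_on UNIV G"
    and p: "is_arg_max (\<lambda>x. z \<bullet> x - regularize mu c G x) (\<lambda>_. True) p"
  shows "z \<bullet> x - regularize mu c G x + mu / 2 * (norm (x - p))\<^sup>2 \<le> z \<bullet> p - regularize mu c G p"
proof -
  let ?h = "\<lambda>x. z \<bullet> x - regularize mu c G x"
  have "s * (mu / 2 * (norm (x - p))\<^sup>2) \<le> ?h p - ?h x" if s: "0 < s" "s < 1" for s
  proof -
    define t where "t = 1 - s"
    have t: "0 < t" "t < 1" using s by (auto simp: t_def)
    define w where "w = p + t *\<^sub>R (x - p)"
    have "w = (1 - t) *\<^sub>R p + t *\<^sub>R x" by (simp add: w_def algebra_simps)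
    then have G: "G w \<le> (1 - t) * G p + t * G x"
      using convex_onD[OF cv, of t p x] t by simp
    have n: "(norm (w - c))\<^sup>2 = (1 - t) * (norm (p - c))\<^sup>2 + t * (norm (x - c))\<^sup>2
        - t * (1 - t) * (norm (x - p))\<^sup>2"
      unfolding w_def by (rule norm_convex_combination_power2)
    have "?h w \<le> ?h p" using p by (auto simp: is_arg_max_def not_less)
    moreover have "z \<bullet> w = (1 - t) * (z \<bullet> p) + t * (z \<bullet> x)"
      by (simp add: w_def algebra_simps)
    ultimately have "t * (?h x - ?h p + (1 - t) * (mu / 2 * (norm (x - p))\<^sup>2)) \<le> 0"
      using G by (simp add: regularize_def n algebra_simps) argo
    then have "?h x - ?h p + (1 - t) * (mu / 2 * (norm (x - p))\<^sup>2) \<le> 0"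
      using t by (simp add: mult_le_0_iff)
    then show ?thesis by (simp add: t_def)
  qed
  then have "mu / 2 * (norm (x - p))\<^sup>2 \<le> ?h p - ?h x"
    by (rule field_le_mult_one_interval)
  then show ?thesis by simp
qed

lemma primal_point_is_arg_max:
  fixes G :: "'v::euclidean_space \<Rightarrow> real"
  assumes "convex_on UNIV G" "mu > 0"
  shows "is_arg_max (\<lambda>x. z \<bullet> x - regularize mu c G x) (\<lambda>_. True)
    (primal_point (regularize mu c G) z)"
  unfolding primal_point_def arg_max_def
  by (rule someI_ex) (rule regularized_arg_max_exists[OF assms])

lemma primal_point_growth:
  fixes G :: "'v::euclidean_space \<Rightarrow> real"
  assumes "convex_on UNIV G" "mu > 0"
  shows "z \<bullet> x - regularize mu c G x + mu / 2 * (norm (x - primal_point (regularize mu c G) z))\<^sup>2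
    \<le> z \<bullet> primal_point (regularize mu c G) z - regularize mu c G (primal_point (regularize mu c G) z)"
  by (rule is_arg_max_regularize_growth[OF assms(1) primal_point_is_arg_max[OF assms]])

lemma primal_point_eqI:
  fixes G :: "'v::euclidean_space \<Rightarrow> real"
  assumes cv: "convex_on UNIV G" and mu: "mu > 0"
    and p: "is_arg_max (\<lambda>x. z \<bullet> x - regularize mu c G x) (\<lambda>_. True) p"
  shows "primal_point (regularize mu c G) z = p"
proof -
  let ?x = "primal_point (regularize mu c G) z"
  have "z \<bullet> ?x - regularize mu c G ?x \<le> z \<bullet> p - regularize mu c G p"
    using p by (auto simp: is_arg_max_def not_less)
  with primal_point_growth[OF cv mu, of z p c] have "mu * (norm (p - ?x))\<^sup>2 \<le> 0" by simp
  with mu show ?thesis by (simp add: mult_le_0_iff)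
qed

section \<open>Separable functions on block vectors\<close>

lemma inner_replace_component:
  fixes x z :: "'a::real_inner^'m::finite"
  shows "z \<bullet> (\<chi> i. if i = j then w else x $ i) = z \<bullet> x + z $ j \<bullet> w - z $ j \<bullet> x $ j"
proof -
  have "z \<bullet> (\<chi> i. if i = j then w else x $ i)
      = (\<Sum>i\<in>UNIV. z $ i \<bullet> x $ i + (if i = j then z $ j \<bullet> w - z $ j \<bullet> x $ j else 0))"
    unfolding inner_vec_def by (intro sum.cong) auto
  then show ?thesis by (simp add: sum.distrib inner_vec_def)
qed

lemma regularize_separable:
  fixes f :: "'m::finite \<Rightarrow> 'a::real_inner \<Rightarrow> real"
  shows "regularize mu c (\<lambda>x. \<Sum>i\<in>UNIV. f i (x $ i)) x
    = (\<Sum>i\<in>UNIV. regularize mu (c $ i) (f i) (x $ i))"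
  by (simp add: regularize_def power2_norm_eq_inner inner_vec_def sum.distrib sum_distrib_left)

lemma convex_on_separable:
  fixes f :: "'m::finite \<Rightarrow> 'a::real_inner \<Rightarrow> real"
  assumes "\<And>i. convex_on UNIV (f i)"
  shows "convex_on UNIV (\<lambda>x :: 'a^'m. \<Sum>i\<in>UNIV. f i (x $ i))"
proof (rule convex_onI)
  fix t :: real and x y :: "'a^'m" assume "0 < t" "t < 1"
  then show "(\<Sum>i\<in>UNIV. f i (((1 - t) *\<^sub>R x + t *\<^sub>R y) $ i))
      \<le> (1 - t) * (\<Sum>i\<in>UNIV. f i (x $ i)) + t * (\<Sum>i\<in>UNIV. f i (y $ i))"
    using convex_onD[OF assms]
    by (auto simp: sum_distrib_left simp flip: sum.distrib intro!: sum_mono)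
qed simp

text \<open>Altering only block \<open>j\<close> of the joint maximizer leaves the other summands
  unchanged, so that block solves its own problem; uniqueness does the rest. This justifies the
  node-wise oracle.\<close>

lemma primal_point_separable:
  fixes f :: "'m::finite \<Rightarrow> 'a::euclidean_space \<Rightarrow> real"
  assumes cv: "\<And>i. convex_on UNIV (f i)" and mu: "mu > 0"
  shows "primal_point (regularize mu c (\<lambda>x. \<Sum>i\<in>UNIV. f i (x $ i))) z $ j
    = primal_point (regularize mu (c $ j) (f j)) (z $ j)"
proof (rule sym, rule primal_point_eqI[OF cv mu])
  let ?F = "\<lambda>x :: 'a^'m. \<Sum>i\<in>UNIV. f i (x $ i)"
  define p where "p = primal_point (regularize mu c ?F) z"
  have "z $ j \<bullet> w - regularize mu (c $ j) (f j) w
      \<le> z $ j \<bullet> p $ j - regularize mu (c $ j) (f j) (p $ j)" for w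
  proof -
    define x where "x = (\<chi> i. if i = j then w else p $ i)"
    have "z \<bullet> x - regularize mu c ?F x \<le> z \<bullet> p - regularize mu c ?F p"
      using primal_point_is_arg_max[OF convex_on_separable[of f, OF cv] mu]
      by (auto simp: is_arg_max_def not_less p_def)
    moreover have "z \<bullet> x = z \<bullet> p + z $ j \<bullet> w - z $ j \<bullet> p $ j"
      unfolding x_def by (rule inner_replace_component)
    moreover have "regularize mu c ?F x
        = (\<Sum>i\<in>UNIV. regularize mu (c $ i) (f i) (p $ i) + (if i = j then
            regularize mu (c $ j) (f j) w - regularize mu (c $ j) (f j) (p $ j) else 0))"
      unfolding regularize_separable x_def by (intro sum.cong) auto
    ultimately show ?thesis by (simp add: sum.distrib regularize_separable)
  qed
  then show "is_arg_max (\<lambda>x. z $ j \<bullet> x - regularize mu (c $ j) (f j) x) (\<lambda>_. True)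
      (primal_point (regularize mu c ?F) z $ j)"
    by (auto simp: is_arg_max_def not_less p_def)
qed

section \<open>Extreme eigenvalues of a self-adjoint operator\<close>

text \<open>Minimize the Rayleigh quotient over the unit sphere of \<open>K\<close>. A nonzero
  residual \<open>T u - r *\<^sub>R u\<close>, which invariance keeps in \<open>K\<close>, would be
  a descent direction.\<close>

lemma self_adjoint_minimal_eigenvector:
  fixes T :: "'v::euclidean_space \<Rightarrow> 'v"
  assumes lin: "linear T" and sa: "\<And>x y. x \<bullet> T y = T x \<bullet> y"
    and K: "subspace K" "\<And>x. x \<in> K \<Longrightarrow> T x \<in> K" and y: "y \<in> K" "y \<noteq> 0"
  obtains r u where "u \<in> K" "u \<noteq> 0" "T u = r *\<^sub>R u" "\<And>w. w \<in> K \<Longrightarrow> r * (norm w)\<^sup>2 \<le> w \<bullet> T w"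
proof -
  let ?C = "sphere 0 1 \<inter> K"
  have "compact ?C" by (intro compact_Int_closed closed_subspace K) simp
  moreover have "(1 / norm y) *\<^sub>R y \<in> ?C" using y K by (simp add: subspace_scale)
  moreover have "continuous_on ?C (\<lambda>w. w \<bullet> T w)"
    by (intro continuous_intros linear_continuous_on linear_conv_bounded_linear[THEN iffD1] lin)
  ultimately obtain u where u: "u \<in> ?C" and min: "\<And>w. w \<in> ?C \<Longrightarrow> u \<bullet> T u \<le> w \<bullet> T w"
    using continuous_attains_inf[of ?C "\<lambda>w. w \<bullet> T w"] by blast
  define r where "r = u \<bullet> T u"
  have ge: "r * (norm w)\<^sup>2 \<le> w \<bullet> T w" if w: "w \<in> K" for w
  proof (cases "w = 0")
    case False
    have "(1 / norm w) *\<^sub>R w \<in> ?C" using w False K by (simp add: subspace_scale)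
    from min[OF this] have "r \<le> (w \<bullet> T w) / (norm w)\<^sup>2"
      by (simp add: r_def linear_scale[OF lin] power2_eq_square)
    with False show ?thesis by (simp add: field_simps)
  qed simp
  define w where "w = T u - r *\<^sub>R u"
  have wK: "w \<in> K" using u K by (simp add: w_def subspace_diff subspace_scale)
  \<comment> \<open>The form \<open>x \<bullet> T x - r * (norm x)\<^sup>2\<close> is nonnegative on
    \<open>K\<close> and vanishes at \<open>u\<close>; this is its expansion along the
    residual.\<close>
  have "0 \<le> 2 * t * (norm w)\<^sup>2 + t\<^sup>2 * (w \<bullet> T w - r * (norm w)\<^sup>2)" for t
  proof -
    have "u + t *\<^sub>R w \<in> K" using u wK K by (simp add: subspace_add subspace_scale)
    from ge[OF this] have "r * ((u + t *\<^sub>R w) \<bullet> (u + t *\<^sub>R w)) \<le> (u + t *\<^sub>R w) \<bullet> T (u + t *\<^sub>R w)"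
      by (simp add: power2_norm_eq_inner)
    also have "(u + t *\<^sub>R w) \<bullet> T (u + t *\<^sub>R w) = r + 2 * t * (w \<bullet> T u) + t\<^sup>2 * (w \<bullet> T w)"
      by (simp add: linear_add[OF lin] linear_scale[OF lin] inner_add sa[of u w] inner_commute[of "T u" w]
          r_def power2_eq_square algebra_simps)
    also have "(u + t *\<^sub>R w) \<bullet> (u + t *\<^sub>R w) = u \<bullet> u + 2 * t * (w \<bullet> u) + t\<^sup>2 * (w \<bullet> w)"
      by (simp add: inner_add inner_commute[of u w] power2_eq_square algebra_simps)
    also have "u \<bullet> u = 1" using u by (simp add: dot_square_norm)
    finally have "r * (1 + 2 * t * (w \<bullet> u) + t\<^sup>2 * (w \<bullet> w)) \<le> r + 2 * t * (w \<bullet> T u) + t\<^sup>2 * (w \<bullet> T w)" .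
    moreover have "w \<bullet> T u = (norm w)\<^sup>2 + r * (w \<bullet> u)"
      unfolding power2_norm_eq_inner by (subst (3) w_def) (simp add: inner_diff_right)
    ultimately show ?thesis
      by (simp add: power2_norm_eq_inner algebra_simps)
  qed
  then have *: "0 \<le> 2 * t * a + t\<^sup>2 * b" if "a = (norm w)\<^sup>2" "b = w \<bullet> T w - r * (norm w)\<^sup>2" for t a b
    using that by blast
  have "w = 0"
  proof (rule ccontr)
    assume "w \<noteq> 0"
    then have a: "(norm w)\<^sup>2 > 0" by simp
    define a where "a = (norm w)\<^sup>2"
    define b where "b = w \<bullet> T w - r * (norm w)\<^sup>2"
    have b: "b \<ge> 0" using ge[OF wK] by (simp add: b_def)
    \<comment> \<open>For the step \<open>- t\<close>, the linear decrease
      \<open>2 * t\<^sup>2 * (b + 1)\<close> beats the quadratic term \<open>t\<^sup>2 * b\<close>;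
      the added 1 covers \<open>b = 0\<close>.\<close>
    define t where "t = a / (b + 1)"
    have t: "t * (b + 1) = a" using b by (simp add: t_def)
    have "0 \<le> 2 * (- t) * (t * (b + 1)) + (- t)\<^sup>2 * b"
      by (rule *, simp_all only: t) (simp_all only: a_def b_def)
    also have "\<dots> = - (t\<^sup>2 * (b + 2))"
      by (simp add: algebra_simps power2_eq_square)
    also have "\<dots> < 0" using a b by (simp add: a_def t_def)
    finally show False by simp
  qed
  then have "T u = r *\<^sub>R u" by (simp add: w_def)
  moreover have "u \<noteq> 0" using u by auto
  ultimately show thesis using that[of u r] u ge by auto
qed

text \<open>Eigenvectors of distinct eigenvalues are orthogonal, hence independent. Finiteness makes
  \<open>Max\<close> and \<open>Min\<close> of the spectrum meaningful.\<close>

lemma finite_eigenvalues_self_adjoint: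
  fixes T :: "'v::euclidean_space \<Rightarrow> 'v"
  assumes sa: "\<And>x y. x \<bullet> T y = T x \<bullet> y"
  shows "finite (eigenvalues T)"
proof -
  define e where "e r = (SOME v. v \<noteq> 0 \<and> T v = r *\<^sub>R v)" for r
  have e: "e r \<noteq> 0 \<and> T (e r) = r *\<^sub>R e r" if "r \<in> eigenvalues T" for r
    unfolding e_def by (rule someI_ex) (use that in \<open>simp add: eigenvalues_def\<close>)
  have orth: "e r \<bullet> e s = 0" if "r \<in> eigenvalues T" "s \<in> eigenvalues T" "r \<noteq> s" for r s
    using sa[of "e r" "e s"] e that by auto
  have inj: "inj_on e (eigenvalues T)"
    by (rule inj_onI) (metis e orth inner_eq_zero_iff)
  have "pairwise orthogonal (e ` eigenvalues T)"
    by (auto simp: pairwise_def orthogonal_def dest: orth)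
  then have "independent (e ` eigenvalues T)"
    by (rule pairwise_orthogonal_independent) (use e in fastforce)
  then have "finite (e ` eigenvalues T)" by (rule independent_imp_finite)
  with inj show ?thesis by (rule finite_imageD[rotated])
qed

lemma inner_le_lambda_max:
  fixes T :: "'v::euclidean_space \<Rightarrow> 'v"
  assumes lin: "linear T" and sa: "\<And>x y. x \<bullet> T y = T x \<bullet> y"
  shows "x \<bullet> T x \<le> lambda_max T * (norm x)\<^sup>2"
proof (cases "x = 0")
  case False
  have "linear (\<lambda>x. - T x)" using lin by (rule linear_compose_neg)
  then obtain r u where u: "u \<noteq> 0" "- T u = r *\<^sub>R u"
    and ge: "\<And>w. w \<in> UNIV \<Longrightarrow> r * (norm w)\<^sup>2 \<le> w \<bullet> - T w"
    by (rule self_adjoint_minimal_eigenvector[of "\<lambda>x. - T x" UNIV x])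
      (use sa False in simp_all)
  have "T u = (- r) *\<^sub>R u" using u by (metis add.inverse_inverse scaleR_minus_left)
  then have "- r \<in> eigenvalues T" using u by (auto simp: eigenvalues_def)
  then have "- r \<le> lambda_max T"
    unfolding lambda_max_def by (intro Max_ge finite_eigenvalues_self_adjoint sa)
  then have "- r * (norm x)\<^sup>2 \<le> lambda_max T * (norm x)\<^sup>2" by (intro mult_right_mono) auto
  with ge[of x] show ?thesis by simp
qed simp

section \<open>Positive semidefinite square roots\<close>

lemma psd_sqrt_inner:
  assumes "psd_sqrt S T"
  shows "x \<bullet> S y = S x \<bullet> y"
  using adjoint_works[of S x y] assms by (simp add: psd_sqrt_def)

lemma psd_sqrt_linear:
  assumes "psd_sqrt S T"
  shows "linear S" "linear T"
proof -
  show S: "linear S" using assms by (simp add: psd_sqrt_def)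
  have "T = S \<circ> S" using assms by (auto simp: psd_sqrt_def)
  then show "linear T" using linear_compose[OF S S] by simp
qed

lemma psd_sqrt_self_adjoint:
  assumes "psd_sqrt S T"
  shows "x \<bullet> T y = T x \<bullet> y"
  using psd_sqrt_inner[OF assms, of x "S y"] psd_sqrt_inner[OF assms, of "S x" y] assms
  by (simp add: psd_sqrt_def)

lemma psd_sqrt_norm:
  assumes "psd_sqrt S T"
  shows "(norm (S x))\<^sup>2 = x \<bullet> T x"
  using psd_sqrt_inner[OF assms, of x "S x"] assms
  by (simp add: psd_sqrt_def power2_norm_eq_inner)

lemma psd_sqrt_norm_le:
  assumes S: "psd_sqrt S T"
  shows "(norm (S x))\<^sup>2 \<le> lambda_max T * (norm x)\<^sup>2"
  unfolding psd_sqrt_norm[OF S]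
  by (rule inner_le_lambda_max[OF psd_sqrt_linear(2)[OF S] psd_sqrt_self_adjoint[OF S]])

text \<open>The orthogonal complement of the kernel of \<open>S\<close> is invariant under
  \<open>T\<close>, and the least eigenvalue there is nonzero, since its eigenvector would otherwise
  be orthogonal to itself. A nonzero \<open>y\<close> in the complement guarantees that nonzero
  eigenvalues exist.\<close>

lemma psd_sqrt_norm_ge:
  fixes S T :: "'v::euclidean_space \<Rightarrow> 'v"
  assumes S: "psd_sqrt S T" and y: "\<And>p. S p = 0 \<Longrightarrow> y \<bullet> p = 0" "y \<noteq> 0"
  shows "lambda_min_pos T * (norm y)\<^sup>2 \<le> (norm (S y))\<^sup>2"
    and "lambda_min_pos T > 0" and "lambda_min_pos T \<le> lambda_max T"
proof -
  let ?K = "{y. \<forall>p. S p = 0 \<longrightarrow> y \<bullet> p = 0}"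
  note lin = psd_sqrt_linear[OF S]
  have SS: "T x = S (S x)" for x using S by (simp add: psd_sqrt_def)
  have "subspace ?K" by (auto simp: subspace_def inner_add_left)
  moreover have "T x \<in> ?K" for x
    by (simp add: SS flip: psd_sqrt_inner[OF S])
  moreover have "y \<in> ?K" using y by simp
  ultimately obtain r u where u: "u \<in> ?K" "u \<noteq> 0" "T u = r *\<^sub>R u"
    and ge: "\<And>w. w \<in> ?K \<Longrightarrow> r * (norm w)\<^sup>2 \<le> w \<bullet> T w"
    by (rule self_adjoint_minimal_eigenvector[OF lin(2) psd_sqrt_self_adjoint[OF S], of ?K y])
      (use y(2) in blast)+
  have fin: "finite (eigenvalues T)"
    by (intro finite_eigenvalues_self_adjoint psd_sqrt_self_adjoint[OF S])
  have "r \<noteq> 0"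
  proof
    assume "r = 0"
    then have "S u = 0" using u psd_sqrt_norm[OF S, of u] by simp
    with u show False by fastforce
  qed
  with u have r: "r \<in> eigenvalues T - {0}" by (auto simp: eigenvalues_def)
  then have le: "lambda_min_pos T \<le> r" unfolding lambda_min_pos_def using fin by (intro Min_le) auto
  then have "lambda_min_pos T * (norm y)\<^sup>2 \<le> r * (norm y)\<^sup>2" by (intro mult_right_mono) auto
  also have "\<dots> \<le> (norm (S y))\<^sup>2" using ge[OF \<open>y \<in> ?K\<close>] by (simp add: psd_sqrt_norm[OF S])
  finally show "lambda_min_pos T * (norm y)\<^sup>2 \<le> (norm (S y))\<^sup>2" .
  have m: "lambda_min_pos T \<in> eigenvalues T - {0}"
    unfolding lambda_min_pos_def using fin r by (intro Min_in) auto
  then obtain v where v: "v \<noteq> 0" "T v = lambda_min_pos T *\<^sub>R v" by (auto simp: eigenvalues_def)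
  then have "lambda_min_pos T * (norm v)\<^sup>2 = (norm (S v))\<^sup>2"
    using psd_sqrt_norm[OF S, of v] by (simp add: power2_norm_eq_inner)
  then have "0 \<le> lambda_min_pos T * (norm v)\<^sup>2" by simp
  with v m show "lambda_min_pos T > 0" by (auto simp: zero_le_mult_iff)
  from m show "lambda_min_pos T \<le> lambda_max T"
    unfolding lambda_max_def using fin by (intro Max_ge) auto
qed

section \<open>Accelerated gradient descent\<close>

text \<open>The Lyapunov function is \<open>\<Phi> (y k) - \<Phi> u + mu / 2 * (norm (v k - u))\<^sup>2\<close>, where \<open>v k\<close> is the
  point for which \<open>yt k\<close> is the average of \<open>y k\<close> and \<open>v k\<close> with weights proportional to \<open>1\<close> and
  \<open>sqrt (mu / l)\<close>.\<close>

lemma accelerated_gradient_rate: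
  fixes \<Phi> :: "'v::real_inner \<Rightarrow> real" and g :: "'v \<Rightarrow> 'v"
  assumes mu: "0 < mu" "mu \<le> l"
    and smooth: "\<And>y w. \<Phi> w \<le> \<Phi> y + g y \<bullet> (w - y) + l / 2 * (norm (w - y))\<^sup>2"
    and strong: "\<And>y w. \<Phi> y + g y \<bullet> (w - y) + mu / 2 * (norm (w - y))\<^sup>2 \<le> \<Phi> w"
    and init: "yt 0 = y 0"
    and y_Suc: "\<And>k. y (Suc k) = yt k - (1 / l) *\<^sub>R g (yt k)"
    and yt_Suc: "\<And>k. yt (Suc k) = y (Suc k) +
      ((sqrt l - sqrt mu) / (sqrt l + sqrt mu)) *\<^sub>R (y (Suc k) - y k)"
  shows "\<Phi> (y k) - \<Phi> u \<le> (1 - sqrt (mu / l)) ^ k * (\<Phi> (y 0) - \<Phi> u + mu / 2 * (norm (y 0 - u))\<^sup>2)"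
proof -
  have l: "l > 0" using mu by simp
  define q where "q = sqrt (mu / l)"
  have q: "0 < q" "q \<le> 1" "q\<^sup>2 = mu / l" using mu l by (auto simp: q_def)
  have mu_q: "mu = q\<^sup>2 * l" using q l by simp
  have "sqrt mu = q * sqrt l" using q l by (simp add: mu_q real_sqrt_mult)
  then have "(sqrt l - sqrt mu) / (sqrt l + sqrt mu) = (sqrt l * (1 - q)) / (sqrt l * (1 + q))"
    by (simp add: algebra_simps)
  then have beta: "(sqrt l - sqrt mu) / (sqrt l + sqrt mu) = (1 - q) / (1 + q)"
    using l by simp
  \<comment> \<open>The value \<open>y 0\<close> at 0 makes the averaging relation hold initially,
    because \<open>yt 0 = y 0\<close>.\<close>
  define v where "v k = (case k of 0 \<Rightarrow> y 0 | Suc j \<Rightarrow> y j + (1 / q) *\<^sub>R (y (Suc j) - y j))" for k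
  have yt: "(1 + q) *\<^sub>R yt k = y k + q *\<^sub>R v k" for k
  proof (cases k)
    case 0
    then show ?thesis by (simp add: v_def init algebra_simps)
  next
    case (Suc j)
    have "(1 + q) *\<^sub>R yt (Suc j) = (1 + q) *\<^sub>R y (Suc j) + (1 - q) *\<^sub>R (y (Suc j) - y j)"
      unfolding yt_Suc beta using q by (simp add: scaleR_add_right)
    then show ?thesis using Suc q by (simp add: v_def algebra_simps)
  qed
  \<comment> \<open>\<open>v\<close> takes a gradient step of length \<open>q / mu\<close> from an
    average of \<open>v k\<close> and \<open>yt k\<close>. The identity is proved after scaling by
    \<open>q\<close>, where \<open>yt\<close> eliminates \<open>v k\<close>.\<close>
  have v_Suc: "v (Suc k) = (1 - q) *\<^sub>R v k + q *\<^sub>R yt k - (q / mu) *\<^sub>R g (yt k)" for k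
  proof -
    have qv: "q *\<^sub>R v k = (1 + q) *\<^sub>R yt k - y k" using yt[of k] by simp
    have "q *\<^sub>R v (Suc k) = y (Suc k) - (1 - q) *\<^sub>R y k"
      using q by (simp add: v_def algebra_simps)
    also have "\<dots> = yt k - (1 / l) *\<^sub>R g (yt k) - (1 - q) *\<^sub>R y k" by (simp add: y_Suc)
    also have "\<dots> = (1 - q) *\<^sub>R ((1 + q) *\<^sub>R yt k - y k) + q\<^sup>2 *\<^sub>R yt k - (1 / l) *\<^sub>R g (yt k)"
      by (simp add: algebra_simps power2_eq_square)
    also have "1 / l = q * (q / mu)" using q l by (simp add: mu_q power2_eq_square)
    also have "(1 - q) *\<^sub>R ((1 + q) *\<^sub>R yt k - y k) = q *\<^sub>R ((1 - q) *\<^sub>R v k)"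
      unfolding qv[symmetric] by (simp add: mult.commute)
    finally have "q *\<^sub>R v (Suc k) = q *\<^sub>R ((1 - q) *\<^sub>R v k + q *\<^sub>R yt k - (q / mu) *\<^sub>R g (yt k))"
      by (simp add: scaleR_add_right scaleR_diff_right power2_eq_square)
    moreover have "q \<noteq> 0" using q by simp
    ultimately show ?thesis by (rule scaleR_left_imp_eq[rotated])
  qed
  define E where "E k = \<Phi> (y k) - \<Phi> u + mu / 2 * (norm (v k - u))\<^sup>2" for k
  have step: "E (Suc k) \<le> (1 - q) * E k" for k
  proof -
    define a where "a = yt k"
    define d where "d = g a"
    define s where "s = (1 - q) *\<^sub>R (v k - u) + q *\<^sub>R (a - u)"
    have v': "v (Suc k) - u = s - (q / mu) *\<^sub>R d"
      unfolding v_Suc s_def d_def a_def by (simp add: algebra_simps)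
    have y': "y (Suc k) - a = - (1 / l) *\<^sub>R d" by (simp add: y_Suc a_def d_def)
    have "\<Phi> (y (Suc k)) \<le> \<Phi> a + d \<bullet> (y (Suc k) - a) + l / 2 * (norm (y (Suc k) - a))\<^sup>2"
      unfolding d_def by (rule smooth)
    also have "\<dots> = \<Phi> a - (norm d)\<^sup>2 / (2 * l)"
      unfolding y' using l by (simp add: power_mult_distrib power2_eq_square field_simps dot_square_norm)
    finally have 1: "\<Phi> (y (Suc k)) \<le> \<Phi> a - (norm d)\<^sup>2 / (2 * l)" .
    have "(norm (s - (q / mu) *\<^sub>R d))\<^sup>2 = (norm s)\<^sup>2 - 2 * (q / mu) * (d \<bullet> s) + (q / mu)\<^sup>2 * (norm d)\<^sup>2"
      unfolding power2_norm_eq_inner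
      by (simp add: inner_diff inner_commute power2_eq_square)
    then have "mu / 2 * (norm (v (Suc k) - u))\<^sup>2
        = mu / 2 * ((norm s)\<^sup>2 - 2 * (q / mu) * (d \<bullet> s) + (q / mu)\<^sup>2 * (norm d)\<^sup>2)"
      by (simp only: v')
    also have "\<dots> = mu / 2 * (norm s)\<^sup>2 - q * (d \<bullet> s) + (norm d)\<^sup>2 * (q\<^sup>2 / mu) / 2"
      using mu by (simp add: field_simps power2_eq_square)
    also have "q\<^sup>2 / mu = 1 / l" using q l by (simp add: mu_q)
    finally have 2: "mu / 2 * (norm (v (Suc k) - u))\<^sup>2
        = mu / 2 * (norm s)\<^sup>2 - q * (d \<bullet> s) + (norm d)\<^sup>2 / (2 * l)" by simp
    have "(norm s)\<^sup>2 = (1 - q) * (norm (v k - u))\<^sup>2 + q * (norm (a - u))\<^sup>2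
        - q * (1 - q) * (norm (a - v k))\<^sup>2"
      using norm_convex_combination_power2[of "v k" q a u]
      by (simp add: s_def algebra_simps)
    moreover have "0 \<le> q * (1 - q) * (norm (a - v k))\<^sup>2" using q by simp
    ultimately have "(norm s)\<^sup>2 \<le> (1 - q) * (norm (v k - u))\<^sup>2 + q * (norm (a - u))\<^sup>2" by simp
    then have 3: "mu / 2 * (norm s)\<^sup>2
        \<le> mu / 2 * ((1 - q) * (norm (v k - u))\<^sup>2 + q * (norm (a - u))\<^sup>2)"
      using mu by (intro mult_left_mono) auto
    \<comment> \<open>Eliminating \<open>v k\<close> expresses \<open>d \<bullet> s\<close> through
      the directions from \<open>a\<close> to \<open>y k\<close> and to \<open>u\<close>, the linear
      terms of strong convexity at these points.\<close>
    have "q *\<^sub>R s = (1 - q) *\<^sub>R (q *\<^sub>R v k) + q\<^sup>2 *\<^sub>R a - q *\<^sub>R u"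
      by (simp add: s_def algebra_simps power2_eq_square)
    also have "q *\<^sub>R v k = (1 + q) *\<^sub>R a - y k" using yt[of k] by (simp add: a_def)
    finally have "q *\<^sub>R s = (1 - q) *\<^sub>R (a - y k) + q *\<^sub>R (a - u)"
      by (simp add: algebra_simps power2_eq_square)
    then have "d \<bullet> (q *\<^sub>R s) = d \<bullet> ((1 - q) *\<^sub>R (a - y k) + q *\<^sub>R (a - u))" by (rule arg_cong)
    then have 4: "q * (d \<bullet> s) = - (1 - q) * (d \<bullet> (y k - a)) - q * (d \<bullet> (u - a))"
      by (simp add: inner_add_right inner_diff_right algebra_simps)
    have "(1 - q) * (\<Phi> a + d \<bullet> (y k - a) + mu / 2 * (norm (y k - a))\<^sup>2) \<le> (1 - q) * \<Phi> (y k)"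
      unfolding d_def using q by (intro mult_left_mono strong) auto
    moreover have "0 \<le> (1 - q) * (mu / 2 * (norm (y k - a))\<^sup>2)" using q mu by simp
    ultimately have 5: "(1 - q) * (\<Phi> a + d \<bullet> (y k - a)) \<le> (1 - q) * \<Phi> (y k)"
      unfolding distrib_left by linarith
    have 6: "q * (\<Phi> a + d \<bullet> (u - a) + mu / 2 * (norm (a - u))\<^sup>2) \<le> q * \<Phi> u"
      unfolding d_def using q strong[of a u] by (intro mult_left_mono) (auto simp: norm_minus_commute)
    \<comment> \<open>In the sum, the squared norms of \<open>d\<close> cancel between 1 and 2, and
      the squared distances from \<open>a\<close> to \<open>u\<close> between 3 and 6.\<close>
    show ?thesis
      using 1 2 3 4 5 6 unfolding E_def by (simp add: algebra_simps) argo
  qed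
  have "E k \<le> (1 - q) ^ k * E 0"
  proof (induction k)
    case (Suc k)
    have "E (Suc k) \<le> (1 - q) * E k" by (rule step)
    also have "\<dots> \<le> (1 - q) * ((1 - q) ^ k * E 0)" using q Suc by (intro mult_left_mono) auto
    finally show ?case by simp
  qed simp
  moreover have "\<Phi> (y k) - \<Phi> u \<le> E k" using mu by (simp add: E_def)
  moreover have "E 0 = \<Phi> (y 0) - \<Phi> u + mu / 2 * (norm (y 0 - u))\<^sup>2" by (simp add: E_def v_def)
  ultimately show ?thesis by (simp add: q_def)
qed

lemma smooth_minimizer_gradient:
  fixes \<Phi> :: "'v::real_inner \<Rightarrow> real"
  assumes l: "l \<ge> 0"
    and smooth: "\<And>w. \<Phi> w \<le> \<Phi> y + g \<bullet> (w - y) + l / 2 * (norm (w - y))\<^sup>2"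
    and min: "\<And>w. \<Phi> y \<le> \<Phi> w"
  shows "g = 0"
proof -
  define t where "t = 1 / (l + 1)"
  have "t > 0" "l * t < 1" using l by (auto simp: t_def)
  then have p: "t * (1 - l * t / 2) > 0" by (intro mult_pos_pos) auto
  have "\<Phi> y \<le> \<Phi> y + g \<bullet> ((y - t *\<^sub>R g) - y) + l / 2 * (norm ((y - t *\<^sub>R g) - y))\<^sup>2"
    by (rule order_trans[OF min smooth])
  then have "t * (1 - l * t / 2) * (norm g)\<^sup>2 \<le> t * (1 - l * t / 2) * 0"
    by (simp add: power_mult_distrib power2_eq_square dot_square_norm algebra_simps)
  with p have "(norm g)\<^sup>2 \<le> 0" by (simp only: mult_le_cancel_left_pos)
  then show ?thesis by simp
qed

section \<open>The regularized dual problem\<close>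

text \<open>\<open>\<Lambda>\<close> enters as a bound on the squared operator norm of
  \<open>S\<close>; the theorem instantiates it with \<open>lambda_max W\<close>.\<close>

locale regularized_dual =
  fixes G :: "'v::euclidean_space \<Rightarrow> real" and c :: 'v and mu :: real and S :: "'v \<Rightarrow> 'v" and \<Lambda> :: real
  assumes convex: "convex_on UNIV G" and mu: "mu > 0"
    and linear: "linear S" and self_adjoint: "\<And>x y. x \<bullet> S y = S x \<bullet> y"
    and norm_S: "\<And>x. (norm (S x))\<^sup>2 \<le> \<Lambda> * (norm x)\<^sup>2"
begin

abbreviation H where "H \<equiv> regularize mu c G"
abbreviation D where "D \<equiv> dual_fun S H"
definition X where "X y = primal_point H (S y)"
text \<open>By the envelope theorem this is the gradient of \<open>D\<close>;
  \<open>dual_subgradient\<close> and \<open>dual_smooth\<close> express that without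
  derivatives.\<close>

definition grad where "grad y = S (X y)"

lemma \<Lambda>_nonneg: "\<Lambda> \<ge> 0"
proof -
  obtain b :: 'v where "b \<in> Basis" using nonempty_Basis by blast
  have "0 \<le> (norm (S b))\<^sup>2" by simp
  also have "\<dots> \<le> \<Lambda>" using norm_S[of b] \<open>b \<in> Basis\<close> by simp
  finally show ?thesis .
qed

lemma dual_eq: "D y = S y \<bullet> X y - H (X y)"
  unfolding dual_fun_def
proof (rule cSup_eq_maximum)
  show "x \<le> S y \<bullet> X y - H (X y)" if "x \<in> range (\<lambda>x. S y \<bullet> x - H x)" for x
    using that primal_point_is_arg_max[OF convex mu, of "S y" c]
    by (auto simp: X_def is_arg_max_def not_less)
qed simp

lemma dual_growth: "S y \<bullet> x - H x + mu / 2 * (norm (x - X y))\<^sup>2 \<le> D y"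
  unfolding dual_eq X_def by (rule primal_point_growth[OF convex mu])

lemma dual_ge: "S y \<bullet> x - H x \<le> D y"
proof -
  have "0 \<le> mu / 2 * (norm (x - X y))\<^sup>2" using mu by simp
  with dual_growth[of y x] show ?thesis by linarith
qed

lemma grad_inner: "grad y \<bullet> w = S w \<bullet> X y"
  by (simp add: grad_def inner_commute flip: self_adjoint)

lemma dual_subgradient: "D y + grad y \<bullet> (w - y) \<le> D w"
  using dual_ge[of w "X y"]
  by (simp add: dual_eq[of y] grad_inner linear_diff[OF linear] inner_diff_left)

text \<open>Growth at \<open>y\<close> leaves a spare \<open>- mu / 2 * (norm b)\<^sup>2\<close>,
  which absorbs \<open>a \<bullet> b\<close> by completing the square.\<close>

lemma dual_smooth: "D w \<le> D y + grad y \<bullet> (w - y) + (\<Lambda> / mu) / 2 * (norm (w - y))\<^sup>2"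
proof -
  define a where "a = S (w - y)"
  define b where "b = X w - X y"
  have "0 \<le> (norm (a - mu *\<^sub>R b))\<^sup>2" by simp
  also have "\<dots> = (norm a)\<^sup>2 - 2 * mu * (a \<bullet> b) + mu\<^sup>2 * (norm b)\<^sup>2"
    unfolding power2_norm_eq_inner by (simp add: inner_diff inner_commute power2_eq_square algebra_simps)
  also have "\<dots> \<le> \<Lambda> * (norm (w - y))\<^sup>2 - 2 * mu * (a \<bullet> b) + mu\<^sup>2 * (norm b)\<^sup>2"
    using norm_S[of "w - y"] by (simp add: a_def)
  finally have "a \<bullet> b - mu / 2 * (norm b)\<^sup>2 \<le> (\<Lambda> / mu) / 2 * (norm (w - y))\<^sup>2"
    using mu by (simp add: field_simps power2_eq_square)
  moreover have "D w - D y \<le> a \<bullet> X w - mu / 2 * (norm b)\<^sup>2"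
    using dual_growth[of y "X w"]
    by (simp add: dual_eq[of w] a_def b_def linear_diff[OF linear] inner_diff_left)
  moreover have "a \<bullet> X w = grad y \<bullet> (w - y) + a \<bullet> b"
    by (simp add: grad_inner a_def b_def inner_diff linear_diff[OF linear])
  ultimately show ?thesis by linarith
qed

text \<open>Adding the growth inequalities at \<open>y\<close> and \<open>w\<close> makes the primal
  points strongly monotone in \<open>S y\<close>; \<open>norm_S\<close> passes from primal points to
  gradients.\<close>

lemma grad_cocoercive: "mu * (norm (grad w - grad y))\<^sup>2 \<le> \<Lambda> * ((grad w - grad y) \<bullet> (w - y))"
proof -
  have "mu * (norm (X w - X y))\<^sup>2 \<le> (S w - S y) \<bullet> (X w - X y)"
    using dual_growth[of y "X w"] dual_growth[of w "X y"]
    by (simp add: dual_eq inner_diff norm_minus_commute)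
  also have "\<dots> = (grad w - grad y) \<bullet> (w - y)"
    by (simp add: grad_inner inner_diff_left linear_diff[OF linear] inner_diff_right)
  finally have "\<Lambda> * (mu * (norm (X w - X y))\<^sup>2) \<le> \<Lambda> * ((grad w - grad y) \<bullet> (w - y))"
    using \<Lambda>_nonneg by (rule mult_left_mono)
  moreover have "mu * (norm (grad w - grad y))\<^sup>2 \<le> mu * (\<Lambda> * (norm (X w - X y))\<^sup>2)"
    using norm_S[of "X w - X y"] mu by (simp add: grad_def linear_diff[OF linear])
  ultimately show ?thesis by (simp add: mult.left_commute)
qed

lemma grad_lipschitz: "norm (grad w - grad y) \<le> \<Lambda> / mu * norm (w - y)"
proof (cases "grad w = grad y")
  case True
  then show ?thesis using \<Lambda>_nonneg mu by simp
next
  case False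
  have "mu * (norm (grad w - grad y))\<^sup>2 \<le> \<Lambda> * (norm (grad w - grad y) * norm (w - y))"
    by (rule order_trans[OF grad_cocoercive]) (intro mult_left_mono norm_cauchy_schwarz \<Lambda>_nonneg)
  then have "norm (grad w - grad y) * (mu * norm (grad w - grad y))
      \<le> norm (grad w - grad y) * (\<Lambda> * norm (w - y))"
    by (simp add: power2_eq_square mult_ac)
  with False have "mu * norm (grad w - grad y) \<le> \<Lambda> * norm (w - y)" by simp
  with mu show ?thesis by (simp add: field_simps)
qed

text \<open>A function with a supporting affine function at every point is convex.\<close>

lemma dual_convex: "convex_on UNIV D"
proof (rule convex_onI)
  fix t :: real and x y :: 'v assume t: "0 < t" "t < 1"
  define w where "w = (1 - t) *\<^sub>R x + t *\<^sub>R y"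
  have "(1 - t) * (D w + grad w \<bullet> (x - w)) \<le> (1 - t) * D x"
    using t by (intro mult_left_mono dual_subgradient) auto
  moreover have "t * (D w + grad w \<bullet> (y - w)) \<le> t * D y"
    using t by (intro mult_left_mono dual_subgradient) auto
  moreover have "(1 - t) *\<^sub>R (x - w) + t *\<^sub>R (y - w) = 0" by (simp add: w_def algebra_simps)
  then have "(1 - t) * (grad w \<bullet> (x - w)) + t * (grad w \<bullet> (y - w)) = 0"
    by (metis inner_add_right inner_scaleR_right inner_zero_right)
  ultimately show "D ((1 - t) *\<^sub>R x + t *\<^sub>R y) \<le> (1 - t) * D x + t * D y"
    unfolding w_def[symmetric] by (simp add: algebra_simps)
qed simp

lemma dual_minimizer_grad:
  assumes "\<And>w. D y \<le> D w"
  shows "grad y = 0"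
  by (rule smooth_minimizer_gradient[of "\<Lambda> / mu" D y "grad y"])
    (use \<Lambda>_nonneg mu dual_smooth assms in auto)

section \<open>The regularized dual function and its minimizer\<close>

lemma regularized_dual_smooth:
  "regularize mp 0 D w \<le> regularize mp 0 D y + (grad y + mp *\<^sub>R y) \<bullet> (w - y)
    + (\<Lambda> / mu + mp) / 2 * (norm (w - y))\<^sup>2"
  using dual_smooth[of w y]
  by (simp add: regularize_def norm_power2_expand[of w y] inner_add_left algebra_simps add_divide_distrib)

lemma regularized_dual_strong:
  "regularize mp 0 D y + (grad y + mp *\<^sub>R y) \<bullet> (w - y) + mp / 2 * (norm (w - y))\<^sup>2
    \<le> regularize mp 0 D w"
  using dual_subgradient[of y w]
  by (simp add: regularize_def norm_power2_expand[of w y] inner_add_left algebra_simps)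

lemma regularized_dual_stationary:
  assumes mp: "mp > 0" and min: "\<And>w. regularize mp 0 D yr \<le> regularize mp 0 D w"
  shows "grad yr = - mp *\<^sub>R yr"
proof -
  have "grad yr + mp *\<^sub>R yr = 0"
    by (rule smooth_minimizer_gradient[of "\<Lambda> / mu + mp" "regularize mp 0 D" yr])
      (use \<Lambda>_nonneg mu mp regularized_dual_smooth min in auto)
  then show ?thesis by (simp add: eq_neg_iff_add_eq_0)
qed

text \<open>Cocoercivity of the gradient makes the norm of the regularized minimizer smaller than that of
  \<open>ys\<close> by a factor \<open>1 - 1 / \<kappa>\<close>. This slack is what leaves room for an approximate minimizer to
  satisfy the bound on the gradient exactly.\<close>

lemma norm_regularized_minimizer:
  assumes mp: "mp > 0" and min: "\<And>w. regularize mp 0 D yr \<le> regularize mp 0 D w"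
    and ys: "grad ys = 0" and \<kappa>: "\<kappa> = \<Lambda> / (mu * mp) + 1"
  shows "\<kappa> * norm yr \<le> (\<kappa> - 1) * norm ys"
proof (cases "yr = 0")
  case True
  then show ?thesis using \<Lambda>_nonneg mu mp by (simp add: \<kappa>)
next
  case False
  note g = regularized_dual_stationary[OF mp min]
  have \<Lambda>: "\<Lambda> = mu * mp * (\<kappa> - 1)" using mu mp by (simp add: \<kappa>)
  have \<kappa>1: "\<kappa> - 1 \<ge> 0" using \<Lambda>_nonneg mu mp by (simp add: \<kappa>)
  have "mu * (norm (- mp *\<^sub>R yr))\<^sup>2 \<le> \<Lambda> * ((- mp *\<^sub>R yr) \<bullet> (yr - ys))"
    using grad_cocoercive[of yr ys] by (simp add: g ys)
  then have "(mu * mp\<^sup>2) * (norm yr)\<^sup>2 \<le> (mu * mp\<^sup>2) * ((\<kappa> - 1) * (yr \<bullet> ys - (norm yr)\<^sup>2))"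
    using mp by (simp add: \<Lambda> power_mult_distrib dot_square_norm inner_diff_right power2_eq_square
        algebra_simps)
  then have "(norm yr)\<^sup>2 \<le> (\<kappa> - 1) * (yr \<bullet> ys - (norm yr)\<^sup>2)"
    using mu mp by simp
  also have "\<dots> \<le> (\<kappa> - 1) * (norm yr * norm ys - (norm yr)\<^sup>2)"
    using \<kappa>1 by (intro mult_left_mono diff_right_mono norm_cauchy_schwarz)
  finally have "norm yr * (\<kappa> * norm yr) \<le> norm yr * ((\<kappa> - 1) * norm ys)"
    by (simp add: algebra_simps power2_eq_square)
  with False show ?thesis by simp
qed

lemma near_regularized_minimizer:
  assumes mp: "mp > 0" and min: "\<And>w. regularize mp 0 D yr \<le> regularize mp 0 D w"
    and ys: "grad ys = 0" and \<kappa>: "\<kappa> = \<Lambda> / (mu * mp) + 1"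
    and near: "8 * \<kappa>\<^sup>2 * norm (y - yr) \<le> norm ys"
  shows "norm (grad y) \<le> mp * norm ys" and "grad y \<bullet> y \<le> mp * (norm ys)\<^sup>2 / 2"
proof -
  define R where "R = norm ys"
  define \<delta> where "\<delta> = norm (y - yr)"
  note g = regularized_dual_stationary[OF mp min]
  have \<kappa>1: "\<kappa> \<ge> 1" using \<Lambda>_nonneg mu mp by (simp add: \<kappa>)
  have R0: "R \<ge> 0" "\<delta> \<ge> 0" by (auto simp: R_def \<delta>_def)
  have "\<kappa> * norm yr \<le> (\<kappa> - 1) * R"
    unfolding R_def by (rule norm_regularized_minimizer[OF mp min ys \<kappa>])
  also have "\<dots> \<le> \<kappa> * R" using R0 by (intro mult_right_mono) auto
  finally have yr: "norm yr \<le> R" using \<kappa>1 by simp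
  have "1 * \<delta> \<le> \<kappa> * \<delta>" using R0 \<kappa>1 by (intro mult_right_mono) auto
  moreover have "\<kappa> * \<delta> \<le> \<kappa> * (\<kappa> * \<delta>)"
    using \<kappa>1 R0 mult_right_mono[OF \<kappa>1, of "\<kappa> * \<delta>"] by simp
  moreover have *: "8 * (\<kappa> * (\<kappa> * \<delta>)) \<le> R"
    using near by (simp add: \<delta>_def R_def power2_eq_square mult_ac)
  ultimately have \<delta>: "8 * \<delta> \<le> R" "8 * (\<kappa> * \<delta>) \<le> R" by auto
  have "norm (grad y - grad yr) \<le> \<Lambda> / mu * \<delta>" unfolding \<delta>_def by (rule grad_lipschitz)
  also have "\<Lambda> / mu = mp * (\<kappa> - 1)" using mu mp by (simp add: \<kappa>)
  also have "mp * (\<kappa> - 1) * \<delta> \<le> mp * \<kappa> * \<delta>"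
    using mp R0 by (intro mult_right_mono) auto
  finally have lip: "norm (grad y - grad yr) \<le> mp * (\<kappa> * \<delta>)" by (simp add: mult_ac)
  have "norm (grad y) \<le> norm (grad yr) + norm (grad y - grad yr)" by norm
  also have "\<dots> \<le> mp * norm yr + mp * (\<kappa> * \<delta>)" using lip mp by (simp add: g)
  \<comment> \<open>Scaling by \<kappa> exposes the slack: \<open>mp * norm yr\<close> falls short
    of \<open>mp * R\<close> by at least \<open>mp * R / \<kappa>\<close>, which covers the error
    \<open>mp * \<kappa> * \<delta>\<close> because
    \<open>\<kappa>\<^sup>2 * \<delta> \<le> R\<close>.\<close>
  finally have "\<kappa> * norm (grad y) \<le> \<kappa> * (mp * norm yr + mp * (\<kappa> * \<delta>))"
    using \<kappa>1 by (intro mult_left_mono) auto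
  also have "\<dots> = mp * (\<kappa> * norm yr + \<kappa> * (\<kappa> * \<delta>))" by (simp add: algebra_simps)
  also have "\<dots> \<le> mp * ((\<kappa> - 1) * R + R)"
    using * R0 \<delta> norm_regularized_minimizer[OF mp min ys \<kappa>] mp
    by (intro mult_left_mono add_mono) (auto simp flip: R_def)
  also have "\<dots> = \<kappa> * (mp * R)" by (simp add: algebra_simps)
  finally show "norm (grad y) \<le> mp * norm ys" using \<kappa>1 by (simp add: R_def)
  \<comment> \<open>The first term is \<open>- mp * (norm yr)\<^sup>2\<close>; the two errors amount
    to at most 1/8 and 2/8 of \<open>mp * R\<^sup>2\<close>.\<close>
  have "grad y \<bullet> y = grad yr \<bullet> yr + grad yr \<bullet> (y - yr) + (grad y - grad yr) \<bullet> y"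
    by (simp add: inner_diff)
  also have "\<dots> \<le> 0 + mp * R * \<delta> + mp * (\<kappa> * \<delta>) * (R + \<delta>)"
  proof (intro add_mono)
    show "grad yr \<bullet> yr \<le> 0" using mp by (simp add: g)
    have "grad yr \<bullet> (y - yr) \<le> norm (grad yr) * \<delta>" unfolding \<delta>_def by (rule norm_cauchy_schwarz)
    also have "\<dots> \<le> mp * R * \<delta>" using mp yr R0 by (intro mult_right_mono) (auto simp: g)
    finally show "grad yr \<bullet> (y - yr) \<le> mp * R * \<delta>" .
    have "norm y \<le> norm yr + norm (y - yr)" by norm
    then have "norm y \<le> R + \<delta>" using yr by (simp add: \<delta>_def)
    then have "norm (grad y - grad yr) * norm y \<le> mp * (\<kappa> * \<delta>) * (R + \<delta>)"
      using lip mp \<kappa>1 R0 by (intro mult_mono) auto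
    with norm_cauchy_schwarz[of "grad y - grad yr" y]
    show "(grad y - grad yr) \<bullet> y \<le> mp * (\<kappa> * \<delta>) * (R + \<delta>)" by linarith
  qed
  also have "\<dots> \<le> 0 + mp * R * (R / 8) + mp * (R / 8) * (R + R)"
    using mp \<delta> R0 \<kappa>1 by (intro add_mono mult_mono) auto
  also have "\<dots> \<le> mp * R\<^sup>2 / 2" using mp R0 by (simp add: power2_eq_square)
  finally show "grad y \<bullet> y \<le> mp * (norm ys)\<^sup>2 / 2" by (simp add: R_def)
qed

text \<open>Strong convexity turns the function gap into a distance, and smoothness around
  \<open>yr\<close> bounds the initial gap from \<open>y 0 = 0\<close>.\<close>

lemma accelerated_distance_to_minimizer:
  assumes mp: "mp > 0" and min: "\<And>w. regularize mp 0 D yr \<le> regularize mp 0 D w"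
    and l: "l = \<Lambda> / mu + mp"
    and init: "y 0 = 0" "yt 0 = 0"
    and y_Suc: "\<And>k. y (Suc k) = yt k - (1 / l) *\<^sub>R (grad (yt k) + mp *\<^sub>R yt k)"
    and yt_Suc: "\<And>k. yt (Suc k) = y (Suc k) +
      ((sqrt l - sqrt mp) / (sqrt l + sqrt mp)) *\<^sub>R (y (Suc k) - y k)"
  shows "(norm (y k - yr))\<^sup>2 \<le> (1 - sqrt (mp / l)) ^ k * ((l / mp + 1) * (norm yr)\<^sup>2)"
proof -
  let ?\<Phi> = "regularize mp 0 D"
  have lmp: "mp \<le> l" using \<Lambda>_nonneg mu by (simp add: l)
  have stat: "grad yr + mp *\<^sub>R yr = 0" using regularized_dual_stationary[OF mp min] by simp
  have "mp / l \<le> 1" using mp lmp by simp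
  then have q: "0 \<le> 1 - sqrt (mp / l)" by (simp add: real_sqrt_le_1_iff)
  have "mp / 2 * (norm (y k - yr))\<^sup>2 \<le> ?\<Phi> (y k) - ?\<Phi> yr"
    using regularized_dual_strong[of mp yr "y k"] by (simp add: stat)
  also have "\<dots> \<le> (1 - sqrt (mp / l)) ^ k * (?\<Phi> (y 0) - ?\<Phi> yr + mp / 2 * (norm (y 0 - yr))\<^sup>2)"
    by (rule accelerated_gradient_rate[where g = "\<lambda>y. grad y + mp *\<^sub>R y" and yt = yt, OF mp lmp])
      (use regularized_dual_smooth regularized_dual_strong init y_Suc yt_Suc in \<open>simp_all add: l\<close>)
  also have "\<dots> \<le> (1 - sqrt (mp / l)) ^ k * (l / 2 * (norm yr)\<^sup>2 + mp / 2 * (norm yr)\<^sup>2)"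
  proof (intro mult_left_mono add_mono)
    show "?\<Phi> (y 0) - ?\<Phi> yr \<le> l / 2 * (norm yr)\<^sup>2"
      using regularized_dual_smooth[of mp 0 yr, folded l] by (simp add: stat init)
    show "0 \<le> (1 - sqrt (mp / l)) ^ k" using q by simp
  qed (use mp in \<open>auto simp: init\<close>)
  also have "\<dots> = mp / 2 * ((1 - sqrt (mp / l)) ^ k * ((l / mp + 1) * (norm yr)\<^sup>2))"
    using mp by (simp add: field_simps)
  finally show ?thesis using mp by simp
qed

text \<open>\<open>S y\<close> is a subgradient of \<open>H\<close> at \<open>X y\<close>: the part
  from \<open>G\<close> has norm at most \<open>M\<close>, the quadratic part is
  \<open>mu *\<^sub>R (X y - c)\<close>.\<close>

lemma norm_dual_point:
  assumes lip: "M-lipschitz_on UNIV G"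
  shows "norm (S y) \<le> M + mu * norm (X y - c)"
proof (cases "S y = 0")
  case True
  then show ?thesis using lipschitz_on_nonneg[OF lip] mu by simp
next
  case False
  define d where "d = S y"
  \<comment> \<open>The growth term cancels the quadratic increment of \<open>H\<close> exactly, so
    one full step \<open>d\<close> replaces a limit of small steps.\<close>
  have "d \<bullet> (X y + d) - H (X y + d) + mu / 2 * (norm d)\<^sup>2 \<le> d \<bullet> X y - H (X y)"
    using dual_growth[of y "X y + d"] by (simp add: d_def dual_eq)
  moreover have "H (X y + d) - H (X y) = G (X y + d) - G (X y) + mu * ((X y - c) \<bullet> d) + mu / 2 * (norm d)\<^sup>2"
  proof -
    have e: "(norm (X y + d - c))\<^sup>2 = (norm (X y - c))\<^sup>2 + 2 * ((X y - c) \<bullet> d) + (norm d)\<^sup>2"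
      using norm_power2_expand[of "X y + d - c" "X y - c"] by simp
    show ?thesis unfolding regularize_def e by (simp add: algebra_simps)
  qed
  moreover have "G (X y + d) - G (X y) \<le> M * norm d"
    using lipschitz_onD[OF lip, of "X y + d" "X y"] by (simp add: dist_norm)
  moreover have "mu * ((X y - c) \<bullet> d) \<le> mu * (norm (X y - c) * norm d)"
    using mu by (intro mult_left_mono norm_cauchy_schwarz) auto
  moreover have "d \<bullet> (X y + d) = d \<bullet> X y + norm d * norm d"
    by (simp add: inner_add_right dot_square_norm power2_eq_square)
  ultimately have "norm d * norm d \<le> M * norm d + mu * (norm (X y - c) * norm d)" by linarith
  also have "\<dots> = (M + mu * norm (X y - c)) * norm d" by (simp add: algebra_simps)
  finally show ?thesis using False by (simp add: d_def)
qed

end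

section \<open>Iteration count, minimal-norm dual solutions and the final estimate\<close>

lemma rate_suffices:
  fixes X \<kappa> :: real
  assumes X: "X \<ge> 1" and \<kappa>: "1 \<le> \<kappa>" "\<kappa> \<le> 5 * X\<^sup>2" and N: "real N \<ge> soft_O X"
  shows "(8 * \<kappa>\<^sup>2)\<^sup>2 * (\<kappa> + 1) * (1 - sqrt (1 / \<kappa>)) ^ N \<le> 1"
proof -
  \<comment> \<open>The prefactor combines the squared accuracy \<open>8 * \<kappa>\<^sup>2\<close>
    of \<open>near_regularized_minimizer\<close> with the initial factor \<open>\<kappa> + 1\<close>
    of the method. It is at most \<open>128 * \<kappa> ^ 5\<close>, hence at most
    \<open>exp (22 + 10 * ln X)\<close>, against a decay of
    \<open>exp (- N / sqrt \<kappa>)\<close>.\<close>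
  have lnX: "ln X \<ge> 0" using X by simp
  have "\<kappa> \<le> (3 * X)\<^sup>2" using \<kappa> by (simp add: power_mult_distrib)
  then have sq: "sqrt \<kappa> \<le> 3 * X" using X by (intro real_le_lsqrt) auto
  have "(22 + 10 * ln X) * sqrt \<kappa> \<le> (22 + 10 * ln X) * (3 * X)"
    using sq lnX by (intro mult_left_mono) auto
  also have "\<dots> \<le> soft_O X"
  proof -
    have "X * (66 + 30 * ln X) \<le> X * (100 + 100 * ln X)" using X lnX by (intro mult_left_mono) auto
    then show ?thesis by (simp add: soft_O_def algebra_simps)
  qed
  also have "\<dots> \<le> real N" by (rule N)
  finally have exponent: "22 + 10 * ln X \<le> real N / sqrt \<kappa>" using \<kappa> by (simp add: field_simps)
  have e2: "2 \<le> exp (1::real)" using exp_ge_add_one_self[of 1] by simp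
  have "(128::real) * 5 ^ 5 \<le> 2 ^ 22" by simp
  also have "\<dots> \<le> exp 1 ^ 22" by (intro power_mono e2) auto
  also have "\<dots> = exp (22::real)" by (simp flip: exp_of_nat_mult)
  finally have e22: "(128::real) * 5 ^ 5 \<le> exp 22" .
  have "(8 * \<kappa>\<^sup>2)\<^sup>2 * (\<kappa> + 1) \<le> (8 * \<kappa>\<^sup>2)\<^sup>2 * (2 * \<kappa>)"
    using \<kappa> by (intro mult_left_mono) auto
  also have "\<dots> = 128 * \<kappa> ^ 5" by (simp add: eval_nat_numeral)
  also have "\<dots> \<le> 128 * (5 * X\<^sup>2) ^ 5" using \<kappa> by (intro mult_left_mono power_mono) auto
  also have "\<dots> = (128 * 5 ^ 5) * X ^ 10" by (simp add: power_mult_distrib flip: power_mult)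
  also have "\<dots> \<le> exp 22 * X ^ 10" using e22 X by (intro mult_right_mono) auto
  also have "X ^ 10 = exp (10 * ln X)" using X exp_of_nat_mult[of 10 "ln X"] by simp
  also have "exp 22 * exp (10 * ln X) = exp (22 + 10 * ln X)" by (simp add: exp_add)
  also have "\<dots> \<le> exp (real N / sqrt \<kappa>)" using exponent by simp
  finally have poly: "(8 * \<kappa>\<^sup>2)\<^sup>2 * (\<kappa> + 1) \<le> exp (real N / sqrt \<kappa>)" .
  have "sqrt (1 / \<kappa>) \<le> 1" using \<kappa> by (simp add: real_sqrt_le_1_iff)
  then have q: "0 \<le> 1 - sqrt (1 / \<kappa>)" by simp
  have "(1 - sqrt (1 / \<kappa>)) ^ N \<le> exp (- sqrt (1 / \<kappa>)) ^ N"
    using exp_ge_add_one_self[of "- sqrt (1 / \<kappa>)"] q by (intro power_mono) auto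
  also have "\<dots> = exp (- (real N / sqrt \<kappa>))"
    by (simp add: real_sqrt_divide flip: exp_of_nat_mult)
  finally have "(8 * \<kappa>\<^sup>2)\<^sup>2 * (\<kappa> + 1) * (1 - sqrt (1 / \<kappa>)) ^ N
      \<le> exp (real N / sqrt \<kappa>) * exp (- (real N / sqrt \<kappa>))"
    using poly q by (intro mult_mono) auto
  then show ?thesis by (simp add: exp_minus)
qed

text \<open>The dual function depends on \<open>y\<close> only through \<open>S y\<close>, so
  removing the component along a kernel vector keeps minimality without raising the norm.\<close>

lemma minimal_norm_dual_minimizer_orthogonal:
  fixes S :: "'v::euclidean_space \<Rightarrow> 'v"
  assumes lin: "linear S" and ys: "is_arg_min norm (is_arg_min (dual_fun S H) (\<lambda>_. True)) ys"
    and p: "S p = 0"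
  shows "ys \<bullet> p = 0"
proof (cases "p = 0")
  case False
  define t where "t = (ys \<bullet> p) / (p \<bullet> p)"
  have t: "t * (p \<bullet> p) = ys \<bullet> p" using False by (simp add: t_def)
  have "dual_fun S H (ys - t *\<^sub>R p) = dual_fun S H ys"
    by (simp add: dual_fun_def linear_diff[OF lin] linear_scale[OF lin] p)
  then have "is_arg_min (dual_fun S H) (\<lambda>_. True) (ys - t *\<^sub>R p)"
    using ys by (simp add: is_arg_min_def)
  then have "norm ys \<le> norm (ys - t *\<^sub>R p)"
    using ys unfolding is_arg_min_def[of norm] by (auto simp: not_less)
  then have "(norm ys)\<^sup>2 \<le> (norm (ys - t *\<^sub>R p))\<^sup>2" by (intro power_mono) auto
  also have "\<dots> = (norm ys)\<^sup>2 - 2 * t * (ys \<bullet> p) + t * (t * (p \<bullet> p))"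
    unfolding power2_norm_eq_inner by (simp add: inner_diff inner_commute)
  finally have "t * (ys \<bullet> p) \<le> 0" unfolding t by simp
  then have "t * t * (p \<bullet> p) \<le> 0" by (simp flip: t add: mult_ac)
  moreover have "p \<bullet> p > 0" using False by simp
  ultimately have "t * t \<le> 0" by (simp add: mult_le_0_iff)
  then have "t = 0" by (metis antisym mult_eq_0_iff zero_le_square)
  with t show ?thesis by simp
qed simp

theorem theorem4p5:
  fixes E :: "('m::finite \<times> 'm) set"
    and f :: "'m \<Rightarrow> real^'n::finite \<Rightarrow> real"
    and F :: "real^'n^'m \<Rightarrow> real"
    and W S :: "real^'n^'m \<Rightarrow> real^'n^'m"
    and c xs ys :: "real^'n^'m"
    and z zt :: "nat \<Rightarrow> real^'n^'m"
    and M \<epsilon> Rx R \<mu> \<mu>\<phi> l :: real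
  assumes graph: "connected_graph E"
    and W: "W = kron_id (laplacian E)"
    and S: "psd_sqrt S W"
    and convex: "\<And>i. convex_on UNIV (f i)"
    and F: "F = (\<lambda>x. \<Sum>i\<in>UNIV. f i (x $ i))"
    and lipschitz: "M-lipschitz_on UNIV F"
    and eps: "\<epsilon> > 0"
    \<comment> \<open>\<open>c\<close> is a primal point of \<open>F\<close> at the dual starting point \<open>0\<close>\<close>
    and c: "is_arg_max (\<lambda>x. 0 \<bullet> x - F x) (\<lambda>_. True) c"
    \<comment> \<open>\<open>xs\<close> is the solution of the constrained problem closest to \<open>c\<close>\<close>
    and xs: "is_arg_min (\<lambda>x. norm (x - c)) (is_arg_min F (\<lambda>x. S x = 0)) xs"
    and Rx: "Rx = norm (xs - c)" "Rx > 0"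
    and mu: "\<mu> = \<epsilon> / Rx\<^sup>2"
    \<comment> \<open>\<open>ys\<close> is the smallest-norm minimizer of the dual function of the regularized function\<close>
    and ys: "is_arg_min norm (is_arg_min (dual_fun S (regularize \<mu> c F)) (\<lambda>_. True)) ys"
    and R: "R = norm ys"
    and mu_phi: "\<mu>\<phi> = \<epsilon> / R\<^sup>2"
    \<comment> \<open>the distributed fast gradient method\<close>
    and l: "l = lambda_max W / \<mu> + \<mu>\<phi>"
    and z_0: "z 0 = 0" "zt 0 = 0"
    and z_Suc: "\<And>k i. z (Suc k) $ i = zt k $ i - (1 / l) *\<^sub>R
           ((\<Sum>j\<in>UNIV. (laplacian E $ i $ j) *\<^sub>R
               primal_point (regularize \<mu> (c $ j) (f j)) (zt k $ j)) + \<mu>\<phi> *\<^sub>R zt k $ i)"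
    and zt_Suc: "\<And>k i. zt (Suc k) $ i = z (Suc k) $ i +
           ((sqrt l - sqrt \<mu>\<phi>) / (sqrt l + sqrt \<mu>\<phi>)) *\<^sub>R (z (Suc k) $ i - z k $ i)"
  shows "\<forall>N. real N \<ge> soft_O (sqrt (max 1 (M\<^sup>2 * Rx\<^sup>2 / \<epsilon>\<^sup>2) * cond_number W)) \<longrightarrow>
           F (primal_point (regularize \<mu> c F) (z N)) - F xs \<le> \<epsilon> \<and>
           norm (S (primal_point (regularize \<mu> c F) (z N))) \<le> \<epsilon> / R"
proof -
  define \<Lambda> where "\<Lambda> = lambda_max W"
  note lin = psd_sqrt_linear(1)[OF S] and SS = psd_sqrt_inner[OF S]
  note \<mu>_eq = mu
  have \<mu>: "\<mu> > 0" using eps Rx by (simp add: \<mu>_eq)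
  have \<mu>Rx: "\<mu> * Rx = \<epsilon> / Rx" "\<mu> * Rx\<^sup>2 = \<epsilon>" using Rx by (simp_all add: \<mu>_eq power2_eq_square)
  interpret regularized_dual F c \<mu> S \<Lambda>
    using convex_on_separable[of f, OF convex] \<mu> lin SS psd_sqrt_norm_le[OF S]
    by (intro regularized_dual.intro) (simp_all add: F \<Lambda>_def)

  have Fc: "F c \<le> F x" for x using c by (simp add: is_arg_max_def not_less)
  have Sxs: "S xs = 0" and Fxs: "\<And>x. S x = 0 \<Longrightarrow> F xs \<le> F x"
    using xs by (auto simp: is_arg_min_def not_less)
  \<comment> \<open>A feasible \<open>c\<close> would be the solution closest to itself,
    contradicting \<open>Rx > 0\<close>.\<close>
  have Sc: "S c \<noteq> 0"
  proof
    assume "S c = 0"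
    then have "is_arg_min F (\<lambda>x. S x = 0) c" using Fc by (simp add: is_arg_min_def not_less)
    then have "norm (xs - c) \<le> norm (c - c)"
      using xs unfolding is_arg_min_def[of "\<lambda>x. norm (x - c)"] by (auto simp: not_less)
    with Rx show False by simp
  qed
  have ys_min: "D ys \<le> D w" for w
    using ys by (simp add: is_arg_min_def not_less)
  then have grad_ys: "grad ys = 0" by (rule dual_minimizer_grad)
  \<comment> \<open>The primal point at 0 is \<open>c\<close>, so the dual gradient there is the
    nonzero vector \<open>S c\<close>.\<close>
  have "ys \<noteq> 0"
  proof
    assume "ys = 0"
    have "regularize \<mu> c F c \<le> regularize \<mu> c F x" for x
      using Fc[of x] \<mu> by (simp add: regularize_def add_increasing2)
    then have "X 0 = c"
      unfolding X_def linear_0[OF lin]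
      by (intro primal_point_eqI[OF convex \<mu>])
        (simp add: is_arg_max_def not_less)
    then show False using grad_ys Sc \<open>ys = 0\<close> by (simp add: grad_def)
  qed
  then have R0: "R > 0" by (simp add: R)
  have mp: "\<mu>\<phi> > 0" using eps R0 by (simp add: mu_phi)

  note perp = minimal_norm_dual_minimizer_orthogonal[OF lin ys]
  note ge = psd_sqrt_norm_ge[OF S perp \<open>ys \<noteq> 0\<close>]
  \<comment> \<open>The primal point of \<open>ys\<close> is feasible and minimizes \<open>H\<close>
    among feasible points, hence is no farther from \<open>c\<close> than \<open>xs\<close>; this
    bounds \<open>S ys\<close>, and orthogonality to the kernel carries the bound to
    \<open>R\<close>.\<close>
  have R_bound: "lambda_min_pos W * R\<^sup>2 \<le> (M + \<epsilon> / Rx)\<^sup>2"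
  proof -
    define x where "x = X ys"
    have Sx: "S x = 0" using grad_ys by (simp add: grad_def x_def)
    have "S ys \<bullet> xs - H xs \<le> S ys \<bullet> x - H x"
      using dual_ge[of ys xs] by (simp add: dual_eq[of ys] x_def)
    moreover have "S ys \<bullet> xs = 0" "S ys \<bullet> x = 0" by (simp_all add: Sxs Sx flip: SS)
    ultimately have "\<mu> / 2 * (norm (x - c))\<^sup>2 \<le> \<mu> / 2 * Rx\<^sup>2"
      using Fxs[OF Sx] by (simp add: regularize_def Rx)
    then have "(norm (x - c))\<^sup>2 \<le> Rx\<^sup>2" using \<mu> by simp
    then have "norm (x - c) \<le> Rx" by (rule power2_le_imp_le) (use Rx in simp)
    then have "\<mu> * norm (x - c) \<le> \<mu> * Rx" using \<mu> by (intro mult_left_mono) auto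
    then have "norm (S ys) \<le> M + \<epsilon> / Rx"
      using norm_dual_point[OF lipschitz, of ys] by (simp add: x_def \<mu>Rx)
    then have "(norm (S ys))\<^sup>2 \<le> (M + \<epsilon> / Rx)\<^sup>2" by (intro power_mono) auto
    with ge(1) show ?thesis by (simp add: R)
  qed

  define A where "A = max 1 (M\<^sup>2 * Rx\<^sup>2 / \<epsilon>\<^sup>2)"
  define cn where "cn = cond_number W"
  define Q where "Q = sqrt (A * cn)"
  define \<kappa> where "\<kappa> = \<Lambda> / (\<mu> * \<mu>\<phi>) + 1"
  have cn: "cn \<ge> 1" using ge by (simp add: cn_def cond_number_def)
  have A: "A \<ge> 1" by (simp add: A_def)
  have "1 * 1 \<le> A * cn" using cn A by (intro mult_mono) auto
  then have Q: "Q \<ge> 1" "Q\<^sup>2 = A * cn" by (auto simp: Q_def)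
  have \<kappa>: "1 \<le> \<kappa>" "\<kappa> \<le> 5 * Q\<^sup>2"
  proof -
    show "1 \<le> \<kappa>" using \<Lambda>_nonneg \<mu> mp by (simp add: \<kappa>_def)
    define B where "B = M * Rx / \<epsilon>"
    have B: "B \<ge> 0" using lipschitz_on_nonneg[OF lipschitz] Rx eps by (simp add: B_def)
    have "(B + 1)\<^sup>2 \<le> 4 * A"
    proof (cases "B \<le> 1")
      case True
      then have "(B + 1)\<^sup>2 \<le> 2\<^sup>2" using B by (intro power_mono) auto
      with A show ?thesis by simp
    next
      case False
      then have "(B + 1)\<^sup>2 \<le> (2 * B)\<^sup>2" by (intro power_mono) auto
      moreover have "B\<^sup>2 \<le> A" by (simp add: A_def B_def power_mult_distrib power_divide)
      ultimately show ?thesis by (simp add: power_mult_distrib)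
    qed
    have "(M + \<epsilon> / Rx)\<^sup>2 * Rx\<^sup>2 / \<epsilon>\<^sup>2 = ((M + \<epsilon> / Rx) * Rx / \<epsilon>)\<^sup>2"
      by (simp add: power_mult_distrib power_divide)
    also have "(M + \<epsilon> / Rx) * Rx / \<epsilon> = B + 1" using Rx eps by (simp add: B_def field_simps)
    finally have B': "(M + \<epsilon> / Rx)\<^sup>2 * Rx\<^sup>2 / \<epsilon>\<^sup>2 = (B + 1)\<^sup>2" .
    \<comment> \<open>Inserting the regularization weights gives
      \<open>\<Lambda> * R\<^sup>2 * Rx\<^sup>2 / \<epsilon>\<^sup>2\<close>; writing \<Lambda> as
      \<open>cn\<close> times the least positive eigenvalue makes \<open>R_bound\<close>
      applicable.\<close>
    have "\<Lambda> / (\<mu> * \<mu>\<phi>) = cn * ((lambda_min_pos W * R\<^sup>2) * Rx\<^sup>2 / \<epsilon>\<^sup>2)"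
      using ge(2) by (simp add: \<mu>_eq mu_phi cn_def cond_number_def \<Lambda>_def power2_eq_square)
    also have "\<dots> \<le> cn * ((M + \<epsilon> / Rx)\<^sup>2 * Rx\<^sup>2 / \<epsilon>\<^sup>2)"
      using R_bound cn by (intro mult_left_mono divide_right_mono mult_right_mono) auto
    also have "\<dots> \<le> cn * (4 * A)"
      unfolding B' using \<open>(B + 1)\<^sup>2 \<le> 4 * A\<close> cn by (intro mult_left_mono) auto
    finally have "\<kappa> \<le> 4 * Q\<^sup>2 + 1" by (simp add: \<kappa>_def Q mult_ac)
    also have "1 \<le> Q\<^sup>2" using Q(1) by simp
    finally show "\<kappa> \<le> 5 * Q\<^sup>2" by simp
  qed

  define \<beta> where "\<beta> = (sqrt l - sqrt \<mu>\<phi>) / (sqrt l + sqrt \<mu>\<phi>)"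
  \<comment> \<open>The iterates are rebuilt in the dual variable, as pairs
    \<open>(y k, yt k)\<close>, since the convergence rate is for the gradient of \<open>D\<close>;
    \<open>z\<close> and \<open>zt\<close> are their images under \<open>S\<close>.\<close>
  define P where "P = rec_nat (0, 0) (\<lambda>_ (a, b).
    let a' = b - (1 / l) *\<^sub>R (grad b + \<mu>\<phi> *\<^sub>R b) in (a', a' + \<beta> *\<^sub>R (a' - a)))"
  define y where "y k = fst (P k)" for k
  define yt where "yt k = snd (P k)" for k
  have y_0: "y 0 = 0" "yt 0 = 0" by (simp_all add: y_def yt_def P_def)
  have y_Suc: "y (Suc k) = yt k - (1 / l) *\<^sub>R (grad (yt k) + \<mu>\<phi> *\<^sub>R yt k)"
    and yt_Suc: "yt (Suc k) = y (Suc k) + \<beta> *\<^sub>R (y (Suc k) - y k)" for k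
    by (simp_all add: y_def yt_def P_def Let_def split: prod.splits)
  have z_Suc': "z (Suc k) = zt k - (1 / l) *\<^sub>R (W (primal_point H (zt k)) + \<mu>\<phi> *\<^sub>R zt k)" for k
    unfolding vec_eq_iff F W kron_id_def
    by (simp add: z_Suc primal_point_separable[OF assms(4) \<mu>])
  have zt_Suc': "zt (Suc k) = z (Suc k) + \<beta> *\<^sub>R (z (Suc k) - z k)" for k
    by (simp add: vec_eq_iff zt_Suc \<beta>_def)
  have z_y: "z k = S (y k) \<and> zt k = S (yt k)" for k
  proof (induction k)
    case 0
    then show ?case by (simp add: z_0 y_0 linear_0[OF lin])
  next
    case (Suc k)
    \<comment> \<open>One factor of \<open>W = S \<circ> S\<close> completes the gradient, the other
      maps it to the \<open>z\<close> variable.\<close>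
    have "W (primal_point H (zt k)) = S (grad (yt k))"
      using S Suc by (simp add: psd_sqrt_def grad_def X_def)
    then show ?case
      using Suc by (simp add: z_Suc' zt_Suc' y_Suc yt_Suc linear_diff[OF lin] linear_add[OF lin]
          linear_scale[OF lin])
  qed

  obtain yr where yr: "\<And>w. regularize \<mu>\<phi> 0 D yr \<le> regularize \<mu>\<phi> 0 D w"
    using regularized_minimizer_exists[OF dual_convex mp] by blast
  have l_mp: "l / \<mu>\<phi> = \<kappa>" using mp \<mu> by (simp add: l \<kappa>_def \<Lambda>_def add_divide_distrib)
  then have mp_l: "\<mu>\<phi> / l = 1 / \<kappa>" by (metis inverse_divide inverse_eq_divide)
  have "\<kappa> * norm yr \<le> (\<kappa> - 1) * R"
    unfolding R by (rule norm_regularized_minimizer[OF mp yr grad_ys \<kappa>_def])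
  also have "\<dots> \<le> \<kappa> * R" using R0 by simp
  finally have norm_yr: "norm yr \<le> R" using \<kappa> by simp

  have "F (primal_point H (z N)) - F xs \<le> \<epsilon> \<and> norm (S (primal_point H (z N))) \<le> \<epsilon> / R"
    if N: "real N \<ge> soft_O Q" for N
  proof -
    define \<rho> where "\<rho> = (1 - sqrt (1 / \<kappa>)) ^ N"
    have "sqrt (1 / \<kappa>) \<le> 1" using \<kappa> by (simp add: real_sqrt_le_1_iff)
    then have \<rho>: "0 \<le> \<rho>" by (simp add: \<rho>_def)
    have "(norm (y N - yr))\<^sup>2 \<le> \<rho> * ((\<kappa> + 1) * (norm yr)\<^sup>2)"
      using accelerated_distance_to_minimizer[OF mp yr l[folded \<Lambda>_def] y_0 y_Suc yt_Suc[unfolded \<beta>_def]]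
      by (simp add: l_mp mp_l \<rho>_def)
    also have "\<dots> \<le> \<rho> * ((\<kappa> + 1) * R\<^sup>2)"
      using \<rho> \<kappa> norm_yr by (intro mult_left_mono power_mono) auto
    finally have "(8 * \<kappa>\<^sup>2)\<^sup>2 * (norm (y N - yr))\<^sup>2 \<le> (8 * \<kappa>\<^sup>2)\<^sup>2 * (\<rho> * ((\<kappa> + 1) * R\<^sup>2))"
      by (intro mult_left_mono) auto
    also have "\<dots> = ((8 * \<kappa>\<^sup>2)\<^sup>2 * (\<kappa> + 1) * \<rho>) * R\<^sup>2" by (simp only: mult_ac)
    also have "\<dots> \<le> 1 * R\<^sup>2"
      unfolding \<rho>_def by (intro mult_right_mono rate_suffices[OF Q(1) \<kappa> N]) auto
    finally have "(8 * \<kappa>\<^sup>2 * norm (y N - yr))\<^sup>2 \<le> R\<^sup>2" by (simp add: power_mult_distrib)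
    then have near: "8 * \<kappa>\<^sup>2 * norm (y N - yr) \<le> norm ys"
      unfolding R by (rule power2_le_imp_le) simp
    note bounds = near_regularized_minimizer[OF mp yr grad_ys \<kappa>_def near, folded R]
    define x where "x = X (y N)"
    have x: "primal_point H (z N) = x" by (simp add: x_def X_def z_y)
    have "norm (S x) \<le> \<epsilon> / R"
      using bounds(1) R0 by (simp add: x_def grad_def mu_phi power2_eq_square)
    moreover have "F x - F xs \<le> \<epsilon>"
    proof -
      \<comment> \<open>Weak duality at the feasible \<open>xs\<close> bounds \<open>H x\<close> by
        \<open>H xs + grad (y N) \<bullet> y N\<close>. Half of \<epsilon> comes from the
        regularization at \<open>xs\<close>, the other half from the inner product.\<close>
      have "S (y N) \<bullet> xs = 0" by (simp add: Sxs flip: SS)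
      then have "- H xs \<le> D (y N)" using dual_ge[of "y N" xs] by simp
      moreover have "D (y N) = grad (y N) \<bullet> y N - H x"
        by (simp add: dual_eq x_def grad_inner)
      moreover have "\<mu>\<phi> * R\<^sup>2 / 2 = \<epsilon> / 2" using R0 by (simp add: mu_phi)
      moreover have "H xs = F xs + \<epsilon> / 2"
        using \<mu>Rx by (simp add: regularize_def flip: Rx(1))
      moreover have "F x \<le> H x" using \<mu> by (simp add: regularize_def)
      ultimately show ?thesis using bounds(2) by linarith
    qed
    ultimately show ?thesis by (simp add: x)
  qed
  then show ?thesis by (simp add: Q_def A_def cn_def)
qed

end
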